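(* Let $H$ be any $(D^4,D,1/5)$-graph. Define a sequence of graphs by $G_1=H^2$ and $G_{i+1}=$ the zig-zag product of $G_i^2$ (as the large graph) with $H$ (as the small graph), for $i\ge1$. Then for every $i\ge 1$, $G_i$ is an $(N_i,D^2,2/5)$-graph with $N_i=D^{4i}$.
   Context: For a positive integer $n$, $[n]=\{1,\dots,n\}$. Graphs are finite, undirected and regular, and may have self-loops and parallel edges. A $D$-regular graph $G$ on $[N]$ is specified by its rotation map $\mathrm{Rot}_G:[N]\times[D]\to[N]\times[D]$: $\mathrm{Rot}_G(v,i)=(w,j)$ means that the $i$-th edge incident to $v$ leads to $w$ and that this edge is the $j$-th edge incident to $w$. Thus $\mathrm{Rot}_G$ is a permutation with $\mathrm{Rot}_G\circ\mathrm{Rot}_G=\mathrm{id}$ (and any such involution specifies a $D$-regular graph). Vertex sets and sets of edge labels may be any finite sets of the right cardinality; when needed they are identified with sets $[n]$ by fixed bijections (e.g. the edge-label set of $G_i^2$, of size $D^4$, is identified with the vertex set of $H$). The normalized adjacency matrix of $G$ is the symmetric $N\times N$ matrix with $M_{u,v}=\frac1D|\{(i,j)\in[D]^2:\mathrm{Rot}_G(u,i)=(v,j)\}|$. The second largest eigenvalue in absolute value is $\lambda(G)=\max_{\alpha\perp 1_N,\,\alpha\ne0}\|M\alpha\|/\|\alpha\|$, where $1_N$ is the all-ones vector and the norm is Euclidean (with $\lambda(G)=0$ if $N=1$). An $(N,D,\lambda)$-graph is a $D$-regular graph on $N$ vertices with $\lambda(G)\le\lambda$. Square: $G^2$ is the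 $D^2$-regular graph on the vertices of $G$ with $\mathrm{Rot}_{G^2}(v_0,(k_1,k_2))=(v_2,(\ell_2,\ell_1))$, where $(v_1,\ell_1)=\mathrm{Rot}_G(v_0,k_1)$ and $(v_2,\ell_2)=\mathrm{Rot}_G(v_1,k_2)$. Zig-zag product: for a $D_1$-regular graph $G_1$ on $[N_1]$ (the large graph) and a $D_2$-regular graph $G_2$ on $[D_1]$ (the small graph), it is the $D_2^2$-regular graph on $[N_1]\times[D_1]$, with edge labels in $[D_2]\times[D_2]$, whose rotation map sends $((v,k),(i,j))$ to $((w,\ell),(j',i'))$, where $(k',i')=\mathrm{Rot}_{G_2}(k,i)$, then $(w,\ell')=\mathrm{Rot}_{G_1}(v,k')$, then $(\ell,j')=\mathrm{Rot}_{G_2}(\ell',j)$. *)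

theory Defs
  imports "HOL-Analysis.Analysis"
begin

text \<open>
  A graph is given by its rotation map. Vertices and edge labels are arbitrary finite sets;
  values of \<open>rot\<close> outside \<open>verts G \<times> labels G\<close> are irrelevant.
\<close>

record ('v, 'e) rgraph =
  verts :: "'v set"
  labels :: "'e set"
  rot :: "'v \<times> 'e \<Rightarrow> 'v \<times> 'e"

definition regular_graph :: "('v, 'e) rgraph \<Rightarrow> bool" where
  "regular_graph G \<longleftrightarrow>
     finite (verts G) \<and> verts G \<noteq> {} \<and> finite (labels G) \<and> labels G \<noteq> {} \<and>
     (\<forall>x \<in> verts G \<times> labels G. rot G x \<in> verts G \<times> labels G \<and> rot G (rot G x) = x)"

definition adj :: "('v, 'e) rgraph \<Rightarrow> 'v \<Rightarrow> 'v \<Rightarrow> real" where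
  "adj G u v =
     real (card {(i, j) \<in> labels G \<times> labels G. rot G (u, i) = (v, j)}) / real (card (labels G))"

definition adj_app :: "('v, 'e) rgraph \<Rightarrow> ('v \<Rightarrow> real) \<Rightarrow> 'v \<Rightarrow> real" where
  "adj_app G \<alpha> u = (\<Sum>v \<in> verts G. adj G u v * \<alpha> v)"

text \<open>
  Vectors indexed by \<open>verts G\<close> are functions of which only the values on \<open>verts G\<close> matter.
  With at least two vertices, the supremum below is over a nonempty bounded set and is attained
  (compactness of the unit sphere), so it is the maximum.
\<close>

definition second_eigenvalue :: "('v, 'e) rgraph \<Rightarrow> real" where
  "second_eigenvalue G =
     (if card (verts G) = 1 then 0
      else SUP \<alpha> \<in> {\<alpha>. (\<Sum>v \<in> verts G. \<alpha> v) = 0 \<and> (\<exists>v \<in> verts G. \<alpha> v \<noteq> 0)}.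
             L2_set (adj_app G \<alpha>) (verts G) / L2_set \<alpha> (verts G))"

definition ndl_graph :: "nat \<Rightarrow> nat \<Rightarrow> real \<Rightarrow> ('v, 'e) rgraph \<Rightarrow> bool" where
  "ndl_graph N D l G \<longleftrightarrow>
     regular_graph G \<and> card (verts G) = N \<and> card (labels G) = D \<and> second_eigenvalue G \<le> l"

definition square :: "('v, 'e) rgraph \<Rightarrow> ('v, 'e \<times> 'e) rgraph" where
  "square G =
     \<lparr>verts = verts G, labels = labels G \<times> labels G,
      rot = (\<lambda>(v0, (k1, k2)).
               let (v1, l1) = rot G (v0, k1);
                   (v2, l2) = rot G (v1, k2)
               in (v2, (l2, l1)))\<rparr>"

text \<open>Meaningful only if \<open>labels G1 = verts G2\<close>.\<close>

definition zigzag :: "('v, 'k) rgraph \<Rightarrow> ('k, 'e) rgraph \<Rightarrow> ('v \<times> 'k, 'e \<times> 'e) rgraph" where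
  "zigzag G1 G2 =
     \<lparr>verts = verts G1 \<times> labels G1, labels = labels G2 \<times> labels G2,
      rot = (\<lambda>((v, k), (i, j)).
               let (k', i') = rot G2 (k, i);
                   (w, l') = rot G1 (v, k');
                   (l, j') = rot G2 (l', j)
               in ((w, l), (j', i')))\<rparr>"

text \<open>
  The copy of \<open>G\<close> obtained by identifying its vertices along \<open>f\<close> and its edge labels along \<open>g\<close>.
  Both maps have to be injective on the respective sets.
\<close>

definition relabel ::
    "('v \<Rightarrow> 'w) \<Rightarrow> ('e \<Rightarrow> 'f) \<Rightarrow> ('v, 'e) rgraph \<Rightarrow> ('w, 'f) rgraph" where
  "relabel f g G =
     \<lparr>verts = f ` verts G, labels = g ` labels G,
      rot = (\<lambda>(w, e). map_prod f g
               (rot G (inv_into (verts G) f w, inv_into (labels G) g e)))\<rparr>"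

end

theory Submission imports Defs
begin

text \<open>
  Write \<open>P\<close> for the walk of the small graph \<open>H\<close> inside every cloud \<open>{v} \<times> labels G\<close> and \<open>Q\<close> for the permutation of the
  vertices of the zig-zag product given by the rotation map of the large graph \<open>G\<close>. The walk operator of
  the product is \<open>P Q P\<close>, and \<open>P\<close> is self-adjoint. Split \<open>f\<close> and \<open>g\<close> into their cloudwise means and
  the remainders: \<open>P\<close> fixes the means and shrinks the remainders by \<open>\<lambda>\<^sub>2\<close>, while \<open>Q\<close> acts on the
  means like the walk of the large graph. Expanding \<open>\<langle>P Q P f, g\<rangle> = \<langle>Q P f, P g\<rangle>\<close> into four terms
  then gives the bound \<open>\<lambda>\<^sub>1 + \<lambda>\<^sub>2 + \<lambda>\<^sub>2\<^sup>2\<close>. Squaring turns \<open>2/5\<close> into \<open>4/25\<close>, and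
  \<open>4/25 + 1/5 + 1/25 = 2/5\<close>. Working with the bilinear form in \<open>f\<close> and \<open>g\<close> instead of the quadratic
  form avoids the spectral theorem.
\<close>

section \<open>The walk operator\<close>

text \<open>Averaging over edge labels instead of summing matrix entries: parallel edges need no
  counting, and rotation maps compose directly.\<close>

definition walk :: "('v, 'e) rgraph \<Rightarrow> ('v \<Rightarrow> real) \<Rightarrow> 'v \<Rightarrow> real" where
  "walk G \<alpha> u = (\<Sum>i \<in> labels G. \<alpha> (fst (rot G (u, i)))) / real (card (labels G))"

text \<open>A product instead of a quotient: neither a supremum nor a nonzero vector is involved,
  and a single vertex is no special case.\<close>

definition spectral_bound :: "('v, 'e) rgraph \<Rightarrow> real \<Rightarrow> bool" where
  "spectral_bound G l \<longleftrightarrow>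
     (\<forall>\<alpha>. (\<Sum>v \<in> verts G. \<alpha> v) = 0 \<longrightarrow> L2_set (walk G \<alpha>) (verts G) \<le> l * L2_set \<alpha> (verts G))"

section \<open>Euclidean norms and elementary facts on rotation maps\<close>

lemma L2_set_power2: "(L2_set f A)\<^sup>2 = (\<Sum>x \<in> A. (f x)\<^sup>2)"
  by (simp add: L2_set_def sum_nonneg)

lemma sum_mult_le_L2_set: "(\<Sum>x \<in> A. f x * g x) \<le> L2_set f A * L2_set g A"
proof -
  have "(\<Sum>x \<in> A. f x * g x) \<le> (\<Sum>x \<in> A. \<bar>f x\<bar> * \<bar>g x\<bar>)"
    by (intro sum_mono) (metis abs_ge_self abs_mult)
  also have "\<dots> \<le> L2_set f A * L2_set g A"
    by (rule L2_set_mult_ineq)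
  finally show ?thesis .
qed

lemma regular_graphD:
  assumes "regular_graph G"
  shows "finite (verts G)" "verts G \<noteq> {}" "finite (labels G)" "labels G \<noteq> {}"
    and "0 < card (labels G)"
    and "v \<in> verts G \<Longrightarrow> i \<in> labels G \<Longrightarrow> fst (rot G (v, i)) \<in> verts G"
    and "v \<in> verts G \<Longrightarrow> i \<in> labels G \<Longrightarrow> snd (rot G (v, i)) \<in> labels G"
    and "v \<in> verts G \<Longrightarrow> i \<in> labels G \<Longrightarrow> rot G (rot G (v, i)) = (v, i)"
  using assms by (auto simp: regular_graph_def card_gt_0_iff mem_Times_iff)

lemma rot_bij_betw:
  assumes "regular_graph G"
  shows "bij_betw (rot G) (verts G \<times> labels G) (verts G \<times> labels G)"
  using assms by (intro bij_betwI[where g = "rot G"]) (auto simp: regular_graph_def)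

text \<open>The label \<open>j\<close> at the far end is determined by \<open>i\<close>, so an entry
  of the matrix counts labels \<open>i\<close>; grouping the labels by the endpoint of their edge
  gives the average.\<close>

lemma adj_app_eq_walk:
  assumes G: "regular_graph G" and u: "u \<in> verts G"
  shows "adj_app G \<alpha> u = walk G \<alpha> u"
proof -
  note [simp] = regular_graphD(1,3)[OF G]
  have adj: "adj G u v = real (card {i \<in> labels G. fst (rot G (u, i)) = v}) / real (card (labels G))" for v
  proof -
    have "bij_betw fst {(i, j) \<in> labels G \<times> labels G. rot G (u, i) = (v, j)}
        {i \<in> labels G. fst (rot G (u, i)) = v}"
      by (rule bij_betwI[where g = "\<lambda>i. (i, snd (rot G (u, i)))"])
         (auto simp: regular_graphD(7)[OF G u] prod_eq_iff)
    then show ?thesis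
      by (simp add: adj_def bij_betw_same_card)
  qed
  have "(\<Sum>v \<in> verts G. real (card {i \<in> labels G. fst (rot G (u, i)) = v}) * \<alpha> v)
      = (\<Sum>v \<in> verts G. \<Sum>i \<in> {i \<in> labels G. fst (rot G (u, i)) = v}. \<alpha> (fst (rot G (u, i))))"
    by (intro sum.cong refl) simp
  also have "\<dots> = (\<Sum>i \<in> labels G. \<alpha> (fst (rot G (u, i))))"
    by (intro sum.group) (auto simp: regular_graphD(6)[OF G u])
  finally show ?thesis
    by (simp add: adj_app_def walk_def adj flip: sum_divide_distrib)
qed

section \<open>Algebraic properties of the walk\<close>

lemma walk_add: "walk G (\<lambda>v. \<alpha> v + \<beta> v) u = walk G \<alpha> u + walk G \<beta> u"
  by (simp add: walk_def sum.distrib add_divide_distrib)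

lemma walk_const:
  assumes "regular_graph G"
  shows "walk G (\<lambda>_. c) u = c"
  using regular_graphD(5)[OF assms] by (simp add: walk_def)

text \<open>Both sides are sums over pairs of a vertex and an incident edge. Reindexing by the
  involution \<open>rot G\<close> traverses every edge backwards and so exchanges its two
  ends.\<close>

lemma walk_self_adjoint:
  assumes G: "regular_graph G"
  shows "(\<Sum>v \<in> verts G. walk G \<alpha> v * \<beta> v) = (\<Sum>v \<in> verts G. \<alpha> v * walk G \<beta> v)"
proof -
  have "(\<Sum>v \<in> verts G. walk G \<alpha> v * \<beta> v)
      = (\<Sum>x \<in> verts G \<times> labels G. \<alpha> (fst (rot G x)) * \<beta> (fst x)) / card (labels G)"
    by (simp add: walk_def sum.cartesian_product' sum_distrib_right sum_divide_distrib)
  also have "(\<Sum>x \<in> verts G \<times> labels G. \<alpha> (fst (rot G x)) * \<beta> (fst x))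
      = (\<Sum>x \<in> verts G \<times> labels G. \<alpha> (fst (rot G (rot G x))) * \<beta> (fst (rot G x)))"
    by (rule sum.reindex_bij_betw[OF rot_bij_betw[OF G], symmetric])
  also have "\<dots> = (\<Sum>x \<in> verts G \<times> labels G. \<alpha> (fst x) * \<beta> (fst (rot G x)))"
    using G by (intro sum.cong) (auto simp: regular_graph_def)
  also have "\<dots> / card (labels G) = (\<Sum>v \<in> verts G. \<alpha> v * walk G \<beta> v)"
    by (simp add: walk_def sum.cartesian_product' sum_distrib_left sum_divide_distrib)
  finally show ?thesis .
qed

lemma sum_walk:
  assumes G: "regular_graph G"
  shows "(\<Sum>v \<in> verts G. walk G \<alpha> v) = (\<Sum>v \<in> verts G. \<alpha> v)"
  using walk_self_adjoint[OF G, of \<alpha> "\<lambda>_. 1"] by (simp add: walk_const[OF G])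

text \<open>Every value of the walk is an average of entries, none of which exceeds the norm of
  \<alpha> in absolute value. This crude bound serves to show that the supremum in
  \<open>second_eigenvalue\<close> is taken over a bounded set.\<close>

lemma walk_L2_set_le:
  assumes G: "regular_graph G"
  shows "L2_set (walk G \<alpha>) (verts G) \<le> sqrt (card (verts G)) * L2_set \<alpha> (verts G)"
proof -
  have "\<bar>walk G \<alpha> u\<bar> \<le> L2_set \<alpha> (verts G)" if u: "u \<in> verts G" for u
  proof -
    have "\<bar>\<Sum>i \<in> labels G. \<alpha> (fst (rot G (u, i)))\<bar> \<le> (\<Sum>i \<in> labels G. \<bar>\<alpha> (fst (rot G (u, i)))\<bar>)"
      by (rule sum_abs)
    also have "\<dots> \<le> (\<Sum>i \<in> labels G. L2_set \<alpha> (verts G))"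
    proof (intro sum_mono)
      fix i assume "i \<in> labels G"
      then have "fst (rot G (u, i)) \<in> verts G"
        using G u by (intro regular_graphD)
      then have "\<bar>\<alpha> (fst (rot G (u, i)))\<bar> \<le> L2_set (\<lambda>v. \<bar>\<alpha> v\<bar>) (verts G)"
        by (rule member_le_L2_set[OF regular_graphD(1)[OF G]])
      then show "\<bar>\<alpha> (fst (rot G (u, i)))\<bar> \<le> L2_set \<alpha> (verts G)"
        by (simp add: L2_set_def)
    qed
    finally show ?thesis
      using regular_graphD(5)[OF G] by (simp add: walk_def divide_le_eq mult.commute)
  qed
  then have "L2_set (\<lambda>u. \<bar>walk G \<alpha> u\<bar>) (verts G) \<le> L2_set (\<lambda>_. L2_set \<alpha> (verts G)) (verts G)"
    by (intro L2_set_mono) auto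
  also have "\<dots> = sqrt (card (verts G)) * L2_set \<alpha> (verts G)"
    by (simp add: L2_set_def real_sqrt_mult sum_nonneg)
  finally show ?thesis
    by (simp add: L2_set_def)
qed

lemma second_eigenvalue_le_iff:
  assumes G: "regular_graph G" and l: "0 \<le> l"
  shows "second_eigenvalue G \<le> l \<longleftrightarrow> spectral_bound G l"
proof -
  note fin = regular_graphD(1)[OF G]
  let ?V = "verts G"
  let ?S = "{\<alpha>. (\<Sum>v \<in> ?V. \<alpha> v) = 0 \<and> (\<exists>v \<in> ?V. \<alpha> v \<noteq> 0)} :: ('a \<Rightarrow> real) set"
  let ?q = "\<lambda>\<alpha>. L2_set (adj_app G \<alpha>) ?V / L2_set \<alpha> ?V"
  have eq: "L2_set (adj_app G \<alpha>) ?V = L2_set (walk G \<alpha>) ?V" for \<alpha>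
    by (intro L2_set_cong refl) (rule adj_app_eq_walk[OF G])
  have pos: "0 < L2_set \<alpha> ?V" if "\<alpha> \<in> ?S" for \<alpha>
  proof -
    have "L2_set \<alpha> ?V \<noteq> 0"
      using that fin by (auto simp: L2_set_eq_0_iff)
    then show ?thesis
      using L2_set_nonneg[of \<alpha> ?V] by linarith
  qed
  have bound_iff: "spectral_bound G l \<longleftrightarrow> (\<forall>\<alpha> \<in> ?S. ?q \<alpha> \<le> l)"
  proof
    assume "spectral_bound G l"
    then show "\<forall>\<alpha> \<in> ?S. ?q \<alpha> \<le> l"
      using pos by (auto simp: spectral_bound_def eq divide_le_eq)
  next
    assume q: "\<forall>\<alpha> \<in> ?S. ?q \<alpha> \<le> l"
    show "spectral_bound G l"
      unfolding spectral_bound_def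
    proof (intro allI impI)
      fix \<alpha> :: "'a \<Rightarrow> real" assume s: "(\<Sum>v \<in> ?V. \<alpha> v) = 0"
      show "L2_set (walk G \<alpha>) ?V \<le> l * L2_set \<alpha> ?V"
      proof (cases "\<alpha> \<in> ?S")
        case True
        then show ?thesis using q pos[OF True] by (auto simp: eq divide_le_eq)
      next
        case False
        \<comment> \<open>A zero-sum vector outside \<open>?S\<close> vanishes on all vertices; the
          crude bound then makes its image vanish too.\<close>
        then have "L2_set \<alpha> ?V = 0"
          using s fin by (auto simp: L2_set_eq_0_iff)
        then show ?thesis using walk_L2_set_le[OF G, of \<alpha>] by simp
      qed
    qed
  qed
  show ?thesis
  proof (cases "card ?V = 1")
    case True
    \<comment> \<open>On one vertex, zero sum forces the zero vector. The value 0 set by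
      \<open>second_eigenvalue\<close> in this case agrees with the vacuous bound because
      \<open>l\<close> is nonnegative.\<close>
    then have "?S = {}"
      by (auto simp: card_1_singleton_iff)
    then have "spectral_bound G l"
      unfolding bound_iff by blast
    then show ?thesis
      using True l by (simp add: second_eigenvalue_def)
  next
    case False
    have "card ?V \<noteq> 0"
      using regular_graphD(1,2)[OF G] by simp
    with False have "\<not> is_singleton ?V" "?V \<noteq> {}"
      by (auto simp: is_singleton_altdef)
    then obtain a b where ab: "a \<in> ?V" "b \<in> ?V" "a \<noteq> b"
      by (metis is_singletonI' ex_in_conv)
    \<comment> \<open>Nonemptiness and boundedness are both needed before a real supremum can be
      compared with \<open>l\<close>. Opposite unit masses on two vertices give a member of
      \<open>?S\<close>.\<close>
    have "(\<lambda>v. if v = a then 1 else if v = b then - 1 else 0) \<in> ?S"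
    proof -
      have "(\<Sum>v \<in> ?V. if v = a then 1 else if v = b then - 1 else 0)
          = (\<Sum>v \<in> ?V. (if v = a then 1 else 0) + (if v = b then - 1 else (0::real)))"
        using ab by (intro sum.cong) auto
      also have "\<dots> = 0"
        using ab fin by (simp add: sum.distrib)
      finally show ?thesis using ab by auto
    qed
    then have ne: "?S \<noteq> {}" by blast
    have "?q \<alpha> \<le> sqrt (card ?V)" if "\<alpha> \<in> ?S" for \<alpha>
      using pos[OF that] walk_L2_set_le[OF G, of \<alpha>] by (simp add: eq divide_le_eq)
    then have bdd: "bdd_above (?q ` ?S)"
      by (rule bdd_aboveI2)
    show ?thesis
      using False by (simp only: second_eigenvalue_def if_False bound_iff cSUP_le_iff[OF ne bdd])
  qed
qed

section \<open>Squares and relabelings\<close>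

lemma regular_graph_square:
  assumes G: "regular_graph G"
  shows "regular_graph (square G)"
  unfolding regular_graph_def
  using regular_graphD[OF G]
  by (auto simp: square_def Let_def split_beta)

lemma walk_square: "walk (square G) \<alpha> u = walk G (walk G \<alpha>) u"
  by (simp add: walk_def square_def Let_def split_beta sum.cartesian_product' card_cartesian_product
      sum_divide_distrib mult.commute)

text \<open>The walk preserves zero sums by \<open>sum_walk\<close>, so the bound for
  \<open>G\<close> applies to \<alpha> and again to its image.\<close>

lemma spectral_bound_square:
  assumes G: "regular_graph G" and b: "spectral_bound G l" and l: "0 \<le> l"
  shows "spectral_bound (square G) (l\<^sup>2)"
  unfolding spectral_bound_def
proof (intro allI impI)
  have V: "verts (square G) = verts G"
    by (simp add: square_def)
  fix \<alpha> :: "_ \<Rightarrow> real"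
  assume "(\<Sum>v \<in> verts (square G). \<alpha> v) = 0"
  then have s: "(\<Sum>v \<in> verts G. \<alpha> v) = 0"
    by (simp add: V)
  then have "L2_set (walk G (walk G \<alpha>)) (verts G) \<le> l * L2_set (walk G \<alpha>) (verts G)"
    using b by (simp add: spectral_bound_def sum_walk[OF G])
  also have "\<dots> \<le> l * (l * L2_set \<alpha> (verts G))"
    using b s l by (intro mult_left_mono) (auto simp: spectral_bound_def)
  finally show "L2_set (walk (square G) \<alpha>) (verts (square G)) \<le> l\<^sup>2 * L2_set \<alpha> (verts (square G))"
    by (simp add: V walk_square[abs_def] power2_eq_square mult.assoc)
qed

section \<open>Invariance under identification of vertices and labels\<close>

lemma rot_relabel:
  assumes "inj_on f (verts G)" "inj_on g (labels G)" "v \<in> verts G" "i \<in> labels G"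
  shows "rot (relabel f g G) (f v, g i) = map_prod f g (rot G (v, i))"
  using assms by (simp add: relabel_def)

lemma regular_graph_relabel:
  assumes G: "regular_graph G" and f: "inj_on f (verts G)" and g: "inj_on g (labels G)"
  shows "regular_graph (relabel f g G)"
proof -
  have V: "verts (relabel f g G) = f ` verts G" and L: "labels (relabel f g G) = g ` labels G"
    by (simp_all add: relabel_def)
  have inv: "rot (relabel f g G) (map_prod f g (rot G (v, i))) = (f v, g i)"
    if "v \<in> verts G" "i \<in> labels G" for v i
    using that rot_relabel[OF f g regular_graphD(6,7)[OF G]] regular_graphD(8)[OF G]
    by (simp add: map_prod_def split_beta)
  show ?thesis
    unfolding regular_graph_def V L
    using regular_graphD[OF G] inv
    by (auto simp: rot_relabel[OF f g] map_prod_def split_beta)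
qed

lemma walk_relabel:
  assumes G: "regular_graph G" and f: "inj_on f (verts G)" and g: "inj_on g (labels G)"
    and v: "v \<in> verts G"
  shows "walk (relabel f g G) \<alpha> (f v) = walk G (\<alpha> \<circ> f) v"
proof -
  have L: "labels (relabel f g G) = g ` labels G"
    by (simp add: relabel_def)
  show ?thesis
    unfolding walk_def L
    using g by (simp add: sum.reindex card_image rot_relabel[OF f g v])
qed

lemma spectral_bound_relabel:
  assumes G: "regular_graph G" and f: "inj_on f (verts G)" and g: "inj_on g (labels G)"
    and b: "spectral_bound G l"
  shows "spectral_bound (relabel f g G) l"
  unfolding spectral_bound_def
proof (intro allI impI)
  have V: "verts (relabel f g G) = f ` verts G"
    by (simp add: relabel_def)
  have L2: "L2_set \<beta> (f ` verts G) = L2_set (\<beta> \<circ> f) (verts G)" for \<beta> :: "_ \<Rightarrow> real"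
    using f by (simp add: L2_set_def sum.reindex)
  fix \<alpha> :: "_ \<Rightarrow> real"
  assume "(\<Sum>v \<in> verts (relabel f g G). \<alpha> v) = 0"
  then have "(\<Sum>v \<in> verts G. (\<alpha> \<circ> f) v) = 0"
    using f by (simp add: V sum.reindex)
  then have "L2_set (walk G (\<alpha> \<circ> f)) (verts G) \<le> l * L2_set (\<alpha> \<circ> f) (verts G)"
    using b by (simp only: spectral_bound_def)
  moreover have "L2_set (walk (relabel f g G) \<alpha> \<circ> f) (verts G) = L2_set (walk G (\<alpha> \<circ> f)) (verts G)"
    by (intro L2_set_cong refl) (simp add: walk_relabel[OF G f g])
  ultimately show "L2_set (walk (relabel f g G) \<alpha>) (verts (relabel f g G))
      \<le> l * L2_set \<alpha> (verts (relabel f g G))"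
    by (simp add: V L2)
qed

section \<open>The zig-zag product\<close>

text \<open>The operator \<open>P\<close> of the overview: the identity on the large graph tensored
  with the walk of \<open>H\<close>.\<close>

definition cloud_walk :: "('k, 'e) rgraph \<Rightarrow> ('v \<times> 'k \<Rightarrow> real) \<Rightarrow> 'v \<times> 'k \<Rightarrow> real" where
  "cloud_walk H f = (\<lambda>(v, k). walk H (\<lambda>k. f (v, k)) k)"

text \<open>Kept as a function of \<open>v\<close> alone, so that the walk of the large graph can
  act on it; composing with \<open>fst\<close> lifts it back to the product.\<close>

definition cloud_mean :: "'k set \<Rightarrow> ('v \<times> 'k \<Rightarrow> real) \<Rightarrow> 'v \<Rightarrow> real" where
  "cloud_mean K f v = (\<Sum>k \<in> K. f (v, k)) / real (card K)"

definition cloud_rest :: "'k set \<Rightarrow> ('v \<times> 'k \<Rightarrow> real) \<Rightarrow> 'v \<times> 'k \<Rightarrow> real" where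
  "cloud_rest K f x = f x - cloud_mean K f (fst x)"

section \<open>Splitting a function into cloud means and remainders\<close>

lemma sum_cloud_rest:
  assumes "finite K" "K \<noteq> {}"
  shows "(\<Sum>k \<in> K. cloud_rest K f (v, k)) = 0"
  using assms by (simp add: cloud_rest_def cloud_mean_def sum_subtractf)

lemma L2_set_cloud_const:
  assumes "finite K"
  shows "L2_set (\<lambda>x. c (fst x)) (V \<times> K) = sqrt (card K) * L2_set c V"
  using assms
  by (simp add: L2_set_def sum.cartesian_product' sum_distrib_left[symmetric] real_sqrt_mult)

text \<open>Pythagoras: within a cloud the cross term is the constant mean times the sum of the
  remainder, which is zero.\<close>

lemma L2_set_cloud_decomposition:
  assumes K: "finite K" "K \<noteq> {}"
  shows "(L2_set f (V \<times> K))\<^sup>2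
    = (L2_set (\<lambda>x. cloud_mean K f (fst x)) (V \<times> K))\<^sup>2 + (L2_set (cloud_rest K f) (V \<times> K))\<^sup>2"
proof -
  let ?c = "cloud_mean K f" and ?r = "cloud_rest K f"
  have "(\<Sum>k \<in> K. (f (v, k))\<^sup>2) = (\<Sum>k \<in> K. (?c v)\<^sup>2) + (\<Sum>k \<in> K. (?r (v, k))\<^sup>2)" for v
  proof -
    have "(f (v, k))\<^sup>2 = (?c v)\<^sup>2 + (?r (v, k))\<^sup>2 + 2 * ?c v * ?r (v, k)" for k
      by (simp add: cloud_rest_def power2_eq_square algebra_simps)
    then have "(\<Sum>k \<in> K. (f (v, k))\<^sup>2)
        = (\<Sum>k \<in> K. (?c v)\<^sup>2) + (\<Sum>k \<in> K. (?r (v, k))\<^sup>2) + 2 * ?c v * (\<Sum>k \<in> K. ?r (v, k))"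
      by (simp add: sum.distrib sum_distrib_left)
    then show ?thesis
      by (simp add: sum_cloud_rest[OF K])
  qed
  then show ?thesis
    unfolding L2_set_power2 by (simp add: sum.cartesian_product' sum.distrib)
qed

section \<open>Rotation map and walk of the zig-zag product\<close>

lemma regular_graph_zigzag:
  assumes G: "regular_graph G" and H: "regular_graph H" and L: "labels G = verts H"
  shows "regular_graph (zigzag G H)"
proof -
  have "rot (zigzag G H) ((v, k), (i, j)) \<in> verts (zigzag G H) \<times> labels (zigzag G H)
      \<and> rot (zigzag G H) (rot (zigzag G H) ((v, k), (i, j))) = ((v, k), (i, j))"
    if "v \<in> verts G" "k \<in> verts H" "i \<in> labels H" "j \<in> labels H" for v k i j
  proof -
    obtain k' i' where 1: "rot H (k, i) = (k', i')" by fastforce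
    obtain w l' where 2: "rot G (v, k') = (w, l')" by fastforce
    obtain l j' where 3: "rot H (l', j) = (l, j')" by fastforce
    have a: "k' \<in> verts H" "i' \<in> labels H" "rot H (k', i') = (k, i)"
      using regular_graphD(6-8)[OF H that(2,3)] by (simp_all add: 1)
    have b: "w \<in> verts G" "l' \<in> verts H" "rot G (w, l') = (v, k')"
      using regular_graphD(6-8)[OF G that(1), of k'] a by (simp_all add: 2 L)
    have c: "l \<in> verts H" "j' \<in> labels H" "rot H (l, j') = (l', j)"
      using regular_graphD(6-8)[OF H b(2) that(4)] by (simp_all add: 3)
    show ?thesis
      using a b c by (simp add: zigzag_def L 1 2 3)
  qed
  moreover have "verts (zigzag G H) = verts G \<times> verts H" "labels (zigzag G H) = labels H \<times> labels H"
    by (simp_all add: zigzag_def L)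
  ultimately show ?thesis
    unfolding regular_graph_def
    using regular_graphD(1-4)[OF G] regular_graphD(1-4)[OF H] by simp
qed

text \<open>The two halves of a label are averaged independently: \<open>j\<close> yields the inner
  cloud walk, applied after the step of the large graph, and \<open>i\<close> the outer one.\<close>

lemma walk_zigzag:
  "walk (zigzag G H) f x = cloud_walk H (cloud_walk H f \<circ> rot G) x"
  by (cases x) (simp add: walk_def cloud_walk_def zigzag_def Let_def split_beta
      sum.cartesian_product' card_cartesian_product sum_divide_distrib)

lemma cloud_walk_self_adjoint:
  assumes H: "regular_graph H"
  shows "(\<Sum>x \<in> V \<times> verts H. cloud_walk H f x * g x) = (\<Sum>x \<in> V \<times> verts H. f x * cloud_walk H g x)"
  by (simp add: sum.cartesian_product' cloud_walk_def walk_self_adjoint[OF H])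

lemma cloud_walk_decomposition:
  assumes H: "regular_graph H"
  shows "cloud_walk H f x = cloud_mean K f (fst x) + cloud_walk H (cloud_rest K f) x"
proof (cases x)
  case (Pair v k)
  have "walk H (\<lambda>k. f (v, k)) k = walk H (\<lambda>k. cloud_mean K f v + cloud_rest K f (v, k)) k"
    by (simp add: cloud_rest_def)
  then show ?thesis
    by (simp add: Pair cloud_walk_def walk_add walk_const[OF H])
qed

text \<open>On each cloud the remainder has zero sum, so the bound for \<open>H\<close> applies
  there; the squared estimates are then added over the clouds.\<close>

lemma L2_set_cloud_walk_rest_le:
  assumes H: "regular_graph H" and b: "spectral_bound H l" and l: "0 \<le> l"
  shows "L2_set (cloud_walk H (cloud_rest (verts H) f)) (V \<times> verts H)
    \<le> l * L2_set (cloud_rest (verts H) f) (V \<times> verts H)"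
proof (rule power2_le_imp_le)
  let ?r = "cloud_rest (verts H) f"
  have "(\<Sum>k \<in> verts H. (cloud_walk H ?r (v, k))\<^sup>2) \<le> l\<^sup>2 * (\<Sum>k \<in> verts H. (?r (v, k))\<^sup>2)" for v
  proof -
    have "L2_set (walk H (\<lambda>k. ?r (v, k))) (verts H) \<le> l * L2_set (\<lambda>k. ?r (v, k)) (verts H)"
      by (rule b[unfolded spectral_bound_def, rule_format, OF sum_cloud_rest[OF regular_graphD(1,2)[OF H]]])
    then have "(L2_set (walk H (\<lambda>k. ?r (v, k))) (verts H))\<^sup>2 \<le> (l * L2_set (\<lambda>k. ?r (v, k)) (verts H))\<^sup>2"
      by (intro power_mono) auto
    then show ?thesis
      by (simp add: power_mult_distrib L2_set_power2 cloud_walk_def)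
  qed
  then show "(L2_set (cloud_walk H ?r) (V \<times> verts H))\<^sup>2 \<le> (l * L2_set ?r (V \<times> verts H))\<^sup>2"
    by (simp add: power_mult_distrib L2_set_power2 sum.cartesian_product' sum_distrib_left[of "l\<^sup>2"] sum_mono)
qed (simp add: l)

text \<open>Here \<open>(a, b)\<close> and \<open>(a', b')\<close> will be the norms of mean part
  and remainder of two functions. Each of the three products is bounded by \<open>n * n'\<close> on
  its own, so the coefficients just add up.\<close>

lemma two_dim_bound:
  fixes a b a' b' n n' l\<^sub>1 l\<^sub>2 :: real
  assumes nonneg: "0 \<le> l\<^sub>1" "0 \<le> l\<^sub>2" "0 \<le> n" "0 \<le> n'"
    and n: "n\<^sup>2 = a\<^sup>2 + b\<^sup>2" and n': "n'\<^sup>2 = a'\<^sup>2 + b'\<^sup>2"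
  shows "l\<^sub>1 * (a * a') + l\<^sub>2 * (a * b' + b * a') + l\<^sub>2\<^sup>2 * (b * b') \<le> (l\<^sub>1 + l\<^sub>2 + l\<^sub>2\<^sup>2) * (n * n')"
proof -
  have sq: "(n * n')\<^sup>2 = (a\<^sup>2 + b\<^sup>2) * (a'\<^sup>2 + b'\<^sup>2)"
    by (simp add: power_mult_distrib n n')
  have nn: "0 \<le> n * n'"
    using nonneg by simp
  \<comment> \<open>The two-square identity, that is, Cauchy-Schwarz for \<open>(a, b)\<close> and
    \<open>(b', a')\<close> with its defect made explicit.\<close>
  have "(a * b' + b * a')\<^sup>2 + (a * a' - b * b')\<^sup>2 = (n * n')\<^sup>2"
    unfolding sq by (simp add: power2_eq_square algebra_simps)
  then have "(a * b' + b * a')\<^sup>2 \<le> (n * n')\<^sup>2"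
    using zero_le_power2[of "a * a' - b * b'"] by linarith
  then have 1: "a * b' + b * a' \<le> n * n'"
    using nn by (rule power2_le_imp_le)
  have "(n * n')\<^sup>2 = (a * a')\<^sup>2 + (a * b')\<^sup>2 + (b * a')\<^sup>2 + (b * b')\<^sup>2"
    unfolding sq by (simp add: power2_eq_square algebra_simps)
  then have "(a * a')\<^sup>2 \<le> (n * n')\<^sup>2" "(b * b')\<^sup>2 \<le> (n * n')\<^sup>2"
    by simp_all
  then have "a * a' \<le> n * n'" "b * b' \<le> n * n'"
    using nn by (auto intro: power2_le_imp_le)
  then show ?thesis
    using 1 nonneg by (auto simp: distrib_right intro!: add_mono mult_left_mono)
qed

lemma spectral_bound_zigzag:
  assumes G: "regular_graph G" and H: "regular_graph H" and L: "labels G = verts H"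
    and bG: "spectral_bound G l\<^sub>1" and bH: "spectral_bound H l\<^sub>2"
    and nonneg: "0 \<le> l\<^sub>1" "0 \<le> l\<^sub>2"
  shows "spectral_bound (zigzag G H) (l\<^sub>1 + l\<^sub>2 + l\<^sub>2\<^sup>2)"
proof -
  define V where "V = verts G"
  define K where "K = verts H"
  define X where "X = V \<times> K"
  have K: "finite K" "K \<noteq> {}"
    using regular_graphD(1,2)[OF H] by (simp_all add: K_def)
  have bij: "bij_betw (rot G) X X"
    using rot_bij_betw[OF G] by (simp add: X_def V_def K_def L)
  \<comment> \<open>\<open>Q\<close> permutes the vertices of the product and is therefore an
    isometry.\<close>
  have L2_rot: "L2_set (f \<circ> rot G) X = L2_set f X" for f
    using sum.reindex_bij_betw[OF bij, of "\<lambda>x. (f x)\<^sup>2"] by (simp add: L2_set_def)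
  define n where "n f = L2_set f X" for f
  define par where "par f x = cloud_mean K f (fst x)" for f and x :: "'a \<times> 'b"
  \<comment> \<open>\<open>per\<close> is the remainder after \<open>P\<close>, hence the factor
    \<open>l\<^sub>2\<close> in \<open>per_le\<close>, whereas the Pythagorean
    \<open>decomposition\<close> uses the remainder itself.\<close>
  define per where "per f = cloud_walk H (cloud_rest K f)" for f :: "'a \<times> 'b \<Rightarrow> real"
  have split: "cloud_walk H f x = par f x + per f x" for f x
    unfolding par_def per_def by (rule cloud_walk_decomposition[OF H])
  have decomposition: "(n f)\<^sup>2 = (n (par f))\<^sup>2 + (n (cloud_rest K f))\<^sup>2" for f
    unfolding n_def par_def[abs_def] X_def by (rule L2_set_cloud_decomposition[OF K])
  have per_le: "n (per f) \<le> l\<^sub>2 * n (cloud_rest K f)" for f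
    using L2_set_cloud_walk_rest_le[OF H bH nonneg(2), of f V] by (simp add: n_def per_def X_def K_def)
  have n_nonneg: "0 \<le> n f" for f
    by (simp add: n_def)
  have inner: "(\<Sum>x \<in> X. (f \<circ> rot G) x * g x) \<le> n f * n g" for f g
    using sum_mult_le_L2_set[of "f \<circ> rot G" g X] unfolding n_def L2_rot .
  have mean: "(\<Sum>x \<in> X. par f (rot G x) * par g x) \<le> l\<^sub>1 * (n (par f) * n (par g))"
    if "(\<Sum>x \<in> X. f x) = 0" for f g
  proof -
    let ?c = "cloud_mean K f" and ?d = "cloud_mean K g"
    \<comment> \<open>Zero sum over the product passes to the cloud means, which makes the bound for
      \<open>G\<close> applicable to \<open>?c\<close>. No such condition falls on
      \<open>g\<close>.\<close>
    have "(\<Sum>v \<in> V. ?c v) = 0"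
      using that by (simp add: cloud_mean_def X_def sum.cartesian_product' sum_divide_distrib[symmetric])
    then have "L2_set (walk G ?c) V \<le> l\<^sub>1 * L2_set ?c V"
      using bG by (simp add: spectral_bound_def V_def)
    then have "L2_set (walk G ?c) V * L2_set ?d V \<le> l\<^sub>1 * L2_set ?c V * L2_set ?d V"
      by (rule mult_right_mono) simp
    with sum_mult_le_L2_set[of "walk G ?c" ?d V]
    have "(\<Sum>v \<in> V. walk G ?c v * ?d v) \<le> l\<^sub>1 * L2_set ?c V * L2_set ?d V"
      by linarith
    then have le: "card K * (\<Sum>v \<in> V. walk G ?c v * ?d v) \<le> card K * (l\<^sub>1 * L2_set ?c V * L2_set ?d V)"
      by (intro mult_left_mono) auto
    \<comment> \<open>The cloud at \<open>v\<close> has one vertex for each edge of the large graph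
      at \<open>v\<close>, so summing over it after \<open>Q\<close> runs through all these edges
      once.\<close>
    have walk: "card K * walk G ?c v = (\<Sum>k \<in> K. ?c (fst (rot G (v, k))))" for v
      using K by (simp add: walk_def L K_def[symmetric])
    have "(\<Sum>x \<in> X. par f (rot G x) * par g x) = (\<Sum>v \<in> V. (card K * walk G ?c v) * ?d v)"
      unfolding walk by (simp add: par_def X_def sum.cartesian_product' sum_distrib_right)
    also have "\<dots> = card K * (\<Sum>v \<in> V. walk G ?c v * ?d v)"
      by (simp add: sum_distrib_left mult.assoc)
    also note le
    \<comment> \<open>The two lifted norms each carry a factor \<open>sqrt (card K)\<close>, which
      together absorb \<open>card K\<close>.\<close>
    also have "card K * (l\<^sub>1 * L2_set ?c V * L2_set ?d V) = l\<^sub>1 * (n (par f) * n (par g))"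
      using K by (simp add: n_def par_def[abs_def] X_def L2_set_cloud_const)
    finally show ?thesis .
  qed
  have form: "(\<Sum>x \<in> X. walk (zigzag G H) f x * g x) \<le> (l\<^sub>1 + l\<^sub>2 + l\<^sub>2\<^sup>2) * (n f * n g)"
    if f: "(\<Sum>x \<in> X. f x) = 0" for f g
  proof -
    \<comment> \<open>Self-adjointness moves the outer \<open>P\<close> onto \<open>g\<close>, so
      both arguments of the form can be split.\<close>
    have "(\<Sum>x \<in> X. walk (zigzag G H) f x * g x)
        = (\<Sum>x \<in> X. cloud_walk H f (rot G x) * cloud_walk H g x)"
      using cloud_walk_self_adjoint[OF H, of "cloud_walk H f \<circ> rot G" g V]
      by (simp add: walk_zigzag X_def K_def)
    also have "\<dots> = (\<Sum>x \<in> X. (par f (rot G x) + per f (rot G x)) * (par g x + per g x))"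
      by (simp only: split)
    also have "\<dots> = (\<Sum>x \<in> X. par f (rot G x) * par g x) + (\<Sum>x \<in> X. (par f \<circ> rot G) x * per g x)
        + (\<Sum>x \<in> X. (per f \<circ> rot G) x * par g x) + (\<Sum>x \<in> X. (per f \<circ> rot G) x * per g x)"
      by (simp add: sum.distrib algebra_simps)
    also have "\<dots> \<le> l\<^sub>1 * (n (par f) * n (par g)) + n (par f) * n (per g)
        + n (per f) * n (par g) + n (per f) * n (per g)"
      by (intro add_mono mean[OF f] inner)
    also have "\<dots> \<le> l\<^sub>1 * (n (par f) * n (par g)) + n (par f) * (l\<^sub>2 * n (cloud_rest K g))
        + (l\<^sub>2 * n (cloud_rest K f)) * n (par g)
        + (l\<^sub>2 * n (cloud_rest K f)) * (l\<^sub>2 * n (cloud_rest K g))"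
      using nonneg by (intro add_mono mult_mono per_le order_refl n_nonneg mult_nonneg_nonneg) auto
    also have "\<dots> = l\<^sub>1 * (n (par f) * n (par g))
        + l\<^sub>2 * (n (par f) * n (cloud_rest K g) + n (cloud_rest K f) * n (par g))
        + l\<^sub>2\<^sup>2 * (n (cloud_rest K f) * n (cloud_rest K g))"
      by (simp add: algebra_simps power2_eq_square)
    also have "\<dots> \<le> (l\<^sub>1 + l\<^sub>2 + l\<^sub>2\<^sup>2) * (n f * n g)"
      by (intro two_dim_bound n_nonneg nonneg decomposition)
    finally show ?thesis .
  qed
  have "n (walk (zigzag G H) f) \<le> (l\<^sub>1 + l\<^sub>2 + l\<^sub>2\<^sup>2) * n f" if f: "(\<Sum>x \<in> X. f x) = 0" for f
  \<comment> \<open>Taking the image of \<open>f\<close> for \<open>g\<close> makes the form a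
    squared norm; one factor of it cancels unless it is zero.\<close>
  proof (cases "n (walk (zigzag G H) f) = 0")
    case True
    then show ?thesis
      using nonneg by (simp add: n_nonneg)
  next
    case False
    have "n (walk (zigzag G H) f) * n (walk (zigzag G H) f)
        = (\<Sum>x \<in> X. walk (zigzag G H) f x * walk (zigzag G H) f x)"
      by (simp add: n_def power2_eq_square[symmetric] L2_set_power2)
    also have "\<dots> \<le> (l\<^sub>1 + l\<^sub>2 + l\<^sub>2\<^sup>2) * n f * n (walk (zigzag G H) f)"
      using form[OF f] by (simp add: mult.assoc)
    finally show ?thesis
      using False n_nonneg[of "walk (zigzag G H) f"] by (simp add: mult_le_cancel_right)
  qed
  moreover have "verts (zigzag G H) = X"
    by (simp add: zigzag_def X_def V_def K_def L)
  ultimately show ?thesis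
    by (simp add: spectral_bound_def n_def)
qed

section \<open>The recursive construction\<close>

lemma ndl_graph_iff:
  assumes "0 \<le> l"
  shows "ndl_graph N D l G \<longleftrightarrow>
    regular_graph G \<and> card (verts G) = N \<and> card (labels G) = D \<and> spectral_bound G l"
  using second_eigenvalue_le_iff[OF _ assms] by (auto simp: ndl_graph_def)

lemma ndl_graph_mono: "ndl_graph N D l G \<Longrightarrow> l \<le> l' \<Longrightarrow> ndl_graph N D l' G"
  by (simp add: ndl_graph_def)

lemma ndl_graph_square:
  assumes "ndl_graph N D l G" "0 \<le> l"
  shows "ndl_graph N (D\<^sup>2) (l\<^sup>2) (square G)"
  using assms regular_graph_square[of G] spectral_bound_square[of G l]
  by (auto simp: ndl_graph_iff) (auto simp: square_def card_cartesian_product power2_eq_square)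

lemma ndl_graph_relabel:
  assumes "ndl_graph N D l G" "0 \<le> l" "inj_on f (verts G)" "inj_on g (labels G)"
  shows "ndl_graph N D l (relabel f g G)"
  using assms regular_graph_relabel[of G f g] spectral_bound_relabel[of G f g l]
  by (auto simp: ndl_graph_iff) (auto simp: relabel_def card_image)

lemma ndl_graph_zigzag:
  assumes "ndl_graph N D\<^sub>1 l\<^sub>1 G" "ndl_graph D\<^sub>1 D\<^sub>2 l\<^sub>2 H" "labels G = verts H" "0 \<le> l\<^sub>1" "0 \<le> l\<^sub>2"
  shows "ndl_graph (N * D\<^sub>1) (D\<^sub>2\<^sup>2) (l\<^sub>1 + l\<^sub>2 + l\<^sub>2\<^sup>2) (zigzag G H)"
  using assms regular_graph_zigzag[of G H] spectral_bound_zigzag[of G H l\<^sub>1 l\<^sub>2]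
  by (auto simp: ndl_graph_iff) (auto simp: zigzag_def card_cartesian_product power2_eq_square)

text \<open>Each zig-zag product enlarges the vertex type, while the sequence needs a single one.
  The maps \<iota> and \<open>\<sigma> i\<close> therefore embed the vertices into one fixed type,
  and \<open>\<phi> i\<close> identifies the labels of the square with the vertices of
  \<open>H\<close>. They are arbitrary, so the result holds for every choice of identifications. The
  label type stays fixed, since the labels of each product come from \<open>H\<close>.\<close>

theorem theorem1p4:
  fixes D :: nat
    and H :: "('k, 'e) rgraph"
    and G :: "nat \<Rightarrow> ('v, 'e \<times> 'e) rgraph"
    and \<iota> :: "'k \<Rightarrow> 'v"
    and \<phi> :: "nat \<Rightarrow> ('e \<times> 'e) \<times> ('e \<times> 'e) \<Rightarrow> 'k"
    and \<sigma> :: "nat \<Rightarrow> 'v \<times> 'k \<Rightarrow> 'v"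
  assumes H: "ndl_graph (D ^ 4) D (1 / 5) H"
    and \<iota>: "inj_on \<iota> (verts H)"
    and \<phi>: "\<And>i. i \<ge> 1 \<Longrightarrow> bij_betw (\<phi> i) (labels (square (G i))) (verts H)"
    and \<sigma>: "\<And>i. i \<ge> 1 \<Longrightarrow> inj_on (\<sigma> i) (verts (G i) \<times> verts H)"
    and G_1: "G 1 = relabel \<iota> id (square H)"
    and G_Suc: "\<And>i. i \<ge> 1 \<Longrightarrow>
      G (i + 1) = relabel (\<sigma> i) id (zigzag (relabel id (\<phi> i) (square (G i))) H)"
  shows "\<forall>i \<ge> 1. ndl_graph (D ^ (4 * i)) (D\<^sup>2) (2 / 5) (G i)"
proof (intro allI impI)
  fix i :: nat
  assume "1 \<le> i"
  then show "ndl_graph (D ^ (4 * i)) (D\<^sup>2) (2 / 5) (G i)"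
  proof (induction i rule: dec_induct)
    case base
    \<comment> \<open>Squaring gives \<open>1 / 25\<close>, which is relaxed to the bound that the
      induction maintains.\<close>
    have "ndl_graph (D ^ 4) (D\<^sup>2) (2 / 5) (square H)"
      using ndl_graph_square[OF H] by (rule ndl_graph_mono) (simp_all add: power2_eq_square)
    then have "ndl_graph (D ^ 4) (D\<^sup>2) (2 / 5) (relabel \<iota> id (square H))"
      using \<iota> by (intro ndl_graph_relabel) (simp_all add: square_def)
    then show ?case
      unfolding G_1 by simp
  next
    case (step i)
    let ?S = "relabel id (\<phi> i) (square (G i))"
    have \<phi>i: "inj_on (\<phi> i) (labels (square (G i)))" "\<phi> i ` labels (square (G i)) = verts H"
      using \<phi>[OF step.hyps(1)] by (auto simp: bij_betw_def)
    have "ndl_graph (D ^ (4 * i)) ((D\<^sup>2)\<^sup>2) ((2 / 5)\<^sup>2) ?S"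
      using step.IH \<phi>i(1) by (intro ndl_graph_relabel ndl_graph_square) simp_all
    \<comment> \<open>The degree of the square is now the number of vertices of \<open>H\<close>, as
      the zig-zag product requires.\<close>
    then have "ndl_graph (D ^ (4 * i)) (D ^ 4) (4 / 25) ?S"
      by (simp add: power_mult[symmetric] power_divide)
    moreover have L: "labels ?S = verts H"
      using \<phi>i(2) by (simp add: relabel_def)
    ultimately have "ndl_graph (D ^ (4 * i) * D ^ 4) (D\<^sup>2) (4 / 25 + 1 / 5 + (1 / 5)\<^sup>2) (zigzag ?S H)"
      using H by (intro ndl_graph_zigzag) simp_all
    then have "ndl_graph (D ^ (4 * Suc i)) (D\<^sup>2) (2 / 5) (zigzag ?S H)"
      by (simp add: power_divide power_add[symmetric] add.commute)
    then have "ndl_graph (D ^ (4 * Suc i)) (D\<^sup>2) (2 / 5) (relabel (\<sigma> i) id (zigzag ?S H))"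
      using \<sigma>[OF step.hyps(1)]
      by (intro ndl_graph_relabel) (simp_all add: zigzag_def L, simp add: relabel_def square_def)
    then show ?case
      using G_Suc[OF step.hyps(1)] by simp
  qed
qed

end
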